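(* For every integer $n \geq 2$, the diameter of the Full-Flag Johnson graph $FJ(n,1)$ is $\binom{n}{2}$.
   Context: For a permutation $u=(u_1,\ldots,u_n)$ of $(1,2,\ldots,n)$ and $i \in [n]=\{1,\ldots,n\}$ write $u(i) = \{u_1, u_2, \ldots, u_i\}$. For integers $0 \leq k < n$, the Full-Flag Johnson graph $FJ(n,k)$ has as vertex set all permutations of $(1,\ldots,n)$; two vertices $u,v$ are adjacent if and only if $u(i) \neq v(i)$ for exactly $k$ integers $i \in [n]$. *)

theory Defs
  imports "HOL-Combinatorics.Multiset_Permutations" "Graph_Theory.Graph_Theory"
begin

text \<open>
  The distance is \<open>\<mu>\<close> with unit arc weights, i.e. the least number of arcs of a walk, which is
  \<open>\<infinity>\<close> if there is none. So the diameter of a disconnected graph is \<open>\<infinity>\<close>.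
\<close>
definition (in wf_digraph) diameter :: ereal where
  "diameter = (SUP u\<in>verts G. SUP v\<in>verts G. \<mu> (\<lambda>_. 1) u v)"

text \<open>
  Vertices are permutations in one-line notation, i.e. the lists \<open>[u\<^sub>1, \<dots>, u\<^sub>n]\<close>, so
  \<open>set (take i u)\<close> is \<open>{u\<^sub>1, \<dots>, u\<^sub>i}\<close>. Undirected edges are pairs of opposite arcs.
  For \<open>k = 0\<close> the adjacency condition read literally gives exactly the loops.
\<close>
definition full_flag_johnson :: "nat \<Rightarrow> nat \<Rightarrow> nat list pair_pre_digraph" where
  "full_flag_johnson n k =
     \<lparr> pverts = permutations_of_set {1..n},
       parcs = {(u, v). u \<in> permutations_of_set {1..n} \<and> v \<in> permutations_of_set {1..n} \<and>
                  card {i \<in> {1..n}. set (take i u) \<noteq> set (take i v)} = k} \<rparr>"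

lemma pair_pseudo_graph_full_flag_johnson: "pair_pseudo_graph (full_flag_johnson n k)"
proof
  let ?V = "permutations_of_set {1..n}"
  show "finite (parcs (full_flag_johnson n k))"
    by (rule finite_subset[of _ "?V \<times> ?V"]) (auto simp: full_flag_johnson_def)
  have "sym (parcs (full_flag_johnson n k))"
  proof (rule symI)
    fix u v assume "(u, v) \<in> parcs (full_flag_johnson n k)"
    moreover have "{i \<in> {1..n}. set (take i v) \<noteq> set (take i u)} =
        {i \<in> {1..n}. set (take i u) \<noteq> set (take i v)}"
      by blast
    ultimately show "(v, u) \<in> parcs (full_flag_johnson n k)"
      by (simp add: full_flag_johnson_def)
  qed
  then show "symmetric (full_flag_johnson n k)"
    by (simp add: symmetric_def)
qed (auto simp: full_flag_johnson_def)

lemma pair_graph_full_flag_johnson: "k > 0 \<Longrightarrow> pair_graph (full_flag_johnson n k)"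
proof -
  assume "k > 0"
  interpret pair_pseudo_graph "full_flag_johnson n k"
    by (rule pair_pseudo_graph_full_flag_johnson)
  show ?thesis
    using \<open>k > 0\<close> by unfold_locales (auto simp: full_flag_johnson_def)
qed

end

(*
  In FJ(n,1), two permutations are adjacent iff they differ by swapping two neighbouring entries.
  Such a swap changes the number of inversions by at most one, so reversing 1, ..., n takes at
  least n choose 2 steps. Conversely, moving the first entry of v to the front of u takes at most
  n - 1 swaps, and recursion on the remaining entries gives (n - 1) + ... + 1 + 0 steps in total.
*)
theory Submission
  imports Defs
begin

text \<open>Set up on arbitrary lists because the sorting recursion passes to tails, which are no
  longer permutations of {1..n}.\<close>

definition adjacent_swaps :: "'a list rel" where
  "adjacent_swaps = {(p @ a # b # q, p @ b # a # q) | p a b q. True}"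

lemma adjacent_swaps_Cons:
  assumes "(u, v) \<in> adjacent_swaps"
  shows "(x # u, x # v) \<in> adjacent_swaps"
proof -
  obtain p a b q where "u = p @ a # b # q" "v = p @ b # a # q"
    using assms by (auto simp: adjacent_swaps_def)
  then show ?thesis
    unfolding adjacent_swaps_def by (intro CollectI exI[of _ "x # p"]) auto
qed

lemma relpow_adjacent_swaps_Cons:
  "(u, v) \<in> adjacent_swaps ^^ k \<Longrightarrow> (x # u, x # v) \<in> adjacent_swaps ^^ k"
  by (induction k arbitrary: v) (auto intro: adjacent_swaps_Cons)

lemma mset_adjacent_swaps: "(u, v) \<in> adjacent_swaps \<Longrightarrow> mset v = mset u"
  by (auto simp: adjacent_swaps_def)

lemma adjacent_swaps_move_to_front:
  "(p @ a # q, a # p @ q) \<in> adjacent_swaps ^^ length p"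
proof (induction p)
  case (Cons b p)
  have "(b # p @ a # q, b # a # p @ q) \<in> adjacent_swaps ^^ length p"
    using Cons.IH by (rule relpow_adjacent_swaps_Cons)
  moreover have "(b # a # p @ q, a # b # p @ q) \<in> adjacent_swaps"
    unfolding adjacent_swaps_def by (intro CollectI exI[of _ "[]"]) auto
  ultimately show ?case by auto
qed simp

lemma adjacent_swaps_sort_bound:
  assumes "mset u = mset v"
  shows "\<exists>k \<le> length v choose 2. (u, v) \<in> adjacent_swaps ^^ k"
  using assms
proof (induction v arbitrary: u)
  case (Cons a v)
  then obtain p q where u: "u = p @ a # q"
    by (metis list.set_intros(1) mset_eq_setD split_list)
  with Cons.prems have eq: "mset (p @ q) = mset v" by simp
  then obtain k where k: "k \<le> length v choose 2" "(p @ q, v) \<in> adjacent_swaps ^^ k"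
    using Cons.IH by blast
  have "(u, a # v) \<in> adjacent_swaps ^^ (length p + k)"
    unfolding relpow_add u
    using adjacent_swaps_move_to_front relpow_adjacent_swaps_Cons[OF k(2)] by (rule relcompI)
  moreover have "length p \<le> length v"
    using arg_cong[OF eq, of size] by simp
  \<comment> \<open>Pascal's rule: \<open>Suc m choose 2\<close> is \<open>m + (m choose 2)\<close>,
    so with \<open>m = length v\<close> the \<open>length p\<close> swaps for the first entry fit
    into the first summand and the recursive \<open>k\<close> into the second.\<close>
  then have "length p + k \<le> length (a # v) choose 2"
    using k(1) by (simp add: numeral_2_eq_2)
  ultimately show ?case by blast
qed (auto intro: exI[of _ 0])

fun inversions :: "'a::linorder list \<Rightarrow> nat" where
  "inversions [] = 0"
| "inversions (x # xs) = length (filter (\<lambda>y. y < x) xs) + inversions xs"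

text \<open>The contribution of an entry of \<open>p\<close> depends only on the multiset of what
  follows it, and the comparisons of \<open>a\<close> and \<open>b\<close> with \<open>q\<close> are
  the same on both sides. Only the pair \<open>a\<close>, \<open>b\<close> itself can become a new
  inversion.\<close>

lemma inversions_adjacent_swap:
  "inversions (p @ b # a # q) \<le> Suc (inversions (p @ a # b # q))"
  by (induction p) auto

lemma inversions_relpow_adjacent_swaps:
  "(u, v) \<in> adjacent_swaps ^^ k \<Longrightarrow> inversions v \<le> inversions u + k"
proof (induction k arbitrary: v)
  case (Suc k)
  then obtain w where "(u, w) \<in> adjacent_swaps ^^ k" "(w, v) \<in> adjacent_swaps" by auto
  moreover from this obtain p a b q where "w = p @ a # b # q" "v = p @ b # a # q"
    by (auto simp: adjacent_swaps_def)
  ultimately show ?case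
    using Suc.IH[of w] inversions_adjacent_swap[of p b a q] by simp
qed simp

lemma inversions_sorted: "sorted xs \<Longrightarrow> inversions xs = 0"
  by (induction xs) (auto simp: filter_empty_conv)

lemma inversions_strict_decreasing:
  "sorted_wrt (>) xs \<Longrightarrow> inversions xs = length xs choose 2"
proof (induction xs)
  case (Cons x xs)
  then have "filter (\<lambda>y. y < x) xs = xs" by (simp add: filter_id_conv)
  with Cons show ?case by (simp add: numeral_2_eq_2)
qed simp

text \<open>Only the prefix ending between the two swapped entries sees the swap: it contains
  \<open>a\<close> but not \<open>b\<close> in one list and \<open>b\<close> but not
  \<open>a\<close> in the other. Shorter prefixes lie inside \<open>p\<close>, longer ones contain
  both entries.\<close>

lemma differing_prefixes_of_adjacent_swap:
  assumes "distinct (p @ a # b # q)"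
  shows "{i. set (take i (p @ a # b # q)) \<noteq> set (take i (p @ b # a # q))} = {Suc (length p)}"
proof -
  have "set (take i (p @ a # b # q)) = set (take i (p @ b # a # q)) \<longleftrightarrow> i \<noteq> Suc (length p)" for i
  proof -
    \<comment> \<open>Naming the excess \<open>j\<close> in the third case lets \<open>take\<close>
      compute past both swapped entries.\<close>
    consider "i \<le> length p" | "i = Suc (length p)" | j where "i = Suc (Suc (length p + j))"
      by (metis add_Suc le_Suc_ex le_antisym not_less_eq_eq)
    then show ?thesis using assms by cases auto
  qed
  then show ?thesis by blast
qed

text \<open>In a distinct list the entry at position \<open>j\<close> is the difference of two
  consecutive prefix sets. Hence the lists agree wherever both of these sets agree, which leaves
  only positions \<open>m\<close> and \<open>Suc m\<close>. The difference two steps apart shows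
  that the same two entries stand there in both lists.\<close>

lemma adjacent_swapI:
  assumes "distinct u" "distinct v" "length v = length u" "Suc m < length u"
    and eq: "\<And>i. i \<le> length u \<Longrightarrow> set (take i u) = set (take i v) \<longleftrightarrow> i \<noteq> Suc m"
  shows "(u, v) \<in> adjacent_swaps"
proof -
  have last: "set (take (Suc j) w) - set (take j w) = {w ! j}"
    if "distinct w" "j < length w" for w :: "'a list" and j
    using that by (auto simp: take_Suc_conv_app_nth distinct_conv_nth in_set_conv_nth)
  have same: "u ! j = v ! j" if "j < length u" "j \<noteq> m" "j \<noteq> Suc m" for j
  proof -
    have "set (take j u) = set (take j v)" "set (take (Suc j) u) = set (take (Suc j) v)"
      using that eq[of j] eq[of "Suc j"] by simp_all
    then have "{u ! j} = {v ! j}"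
      using last[of u j] last[of v j] assms(1-3) that(1) by metis
    then show ?thesis by simp
  qed
  have two: "set (take (Suc (Suc m)) w) - set (take m w) = {w ! m, w ! Suc m}"
    if "distinct w" "Suc m < length w" for w :: "'a list"
    using that by (auto simp: take_Suc_conv_app_nth distinct_conv_nth in_set_conv_nth)
  have "set (take m u) = set (take m v)"
    "set (take (Suc (Suc m)) u) = set (take (Suc (Suc m)) v)"
    using assms(4) eq[of m] eq[of "Suc (Suc m)"] by simp_all
  then have "{u ! m, u ! Suc m} = {v ! m, v ! Suc m}"
    using two[of u] two[of v] assms(1-4) by metis
  \<comment> \<open>Rules out that the two entries stand in the same order: then the prefixes of
    length \<open>Suc m\<close> would agree.\<close>
  moreover have "u ! m \<noteq> v ! m"
  proof
    assume "u ! m = v ! m"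
    with \<open>set (take m u) = set (take m v)\<close> have "set (take (Suc m) u) = set (take (Suc m) v)"
      using assms(3,4) by (simp add: take_Suc_conv_app_nth)
    then show False using assms(4) eq[of "Suc m"] by simp
  qed
  ultimately have cross: "v ! m = u ! Suc m" "v ! Suc m = u ! m"
    by (auto simp: doubleton_eq_iff)
  have split: "w = take m w @ w ! m # w ! Suc m # drop (Suc (Suc m)) w"
    if "Suc m < length w" for w :: "'a list"
    using that by (metis Cons_nth_drop_Suc Suc_lessD id_take_nth_drop)
  have "take m v = take m u" "drop (Suc (Suc m)) v = drop (Suc (Suc m)) u"
    using assms(3,4) same by (auto intro!: nth_equalityI)
  then show ?thesis
    using split[of u] split[of v] assms(3,4) cross unfolding adjacent_swaps_def by fastforce
qed

lemma parcs_full_flag_johnson_1_iff: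
  "(u, v) \<in> parcs (full_flag_johnson n 1) \<longleftrightarrow>
     u \<in> permutations_of_set {1..n} \<and> v \<in> permutations_of_set {1..n} \<and> (u, v) \<in> adjacent_swaps"
proof -
  have "card {i \<in> {1..n}. set (take i u) \<noteq> set (take i v)} = 1 \<longleftrightarrow> (u, v) \<in> adjacent_swaps"
    if perm: "u \<in> permutations_of_set {1..n}" "v \<in> permutations_of_set {1..n}"
  proof
    assume "card {i \<in> {1..n}. set (take i u) \<noteq> set (take i v)} = 1"
    then obtain i where i: "{i \<in> {1..n}. set (take i u) \<noteq> set (take i v)} = {i}"
      by (rule card_1_singletonE)
    have uv: "distinct u" "distinct v" "length u = n" "length v = n" "set u = set v"
      using perm[THEN length_finite_permutations_of_set] perm[THEN permutations_of_setD(1)]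
        perm[THEN permutations_of_setD(2)] by simp_all
    have "i \<in> {1..n}" using i by blast
    have iff: "set (take j u) = set (take j v) \<longleftrightarrow> j \<noteq> i" if "j \<le> n" for j
    proof (cases "j = 0")
      case True
      then show ?thesis using \<open>i \<in> {1..n}\<close> by simp
    next
      case False
      then have "j \<in> {1..n}" using that by simp
      then show ?thesis using i by blast
    qed
    \<comment> \<open>The prefix of length \<open>n\<close> is the whole of {1..n} for both lists.
      So position \<open>i\<close> (counted from 0) still holds an entry, the second of the two to
      be swapped.\<close>
    have "i \<noteq> n" using iff[of n] uv by auto
    then obtain m where "i = Suc m" "Suc m < n"
      using \<open>i \<in> {1..n}\<close> by (cases i) auto
    then show "(u, v) \<in> adjacent_swaps"
      using uv iff by (intro adjacent_swapI[of u v m]) auto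
  next
    assume "(u, v) \<in> adjacent_swaps"
    then obtain p a b q where uv: "u = p @ a # b # q" "v = p @ b # a # q"
      by (auto simp: adjacent_swaps_def)
    have "length u = n" "distinct u"
      using perm by (auto dest: length_finite_permutations_of_set permutations_of_setD)
    \<comment> \<open>The index \<open>Suc (length p)\<close> lies in {1..n}, since one more entry
      follows that prefix.\<close>
    then have "{i \<in> {1..n}. set (take i u) \<noteq> set (take i v)} = {Suc (length p)}"
      using differing_prefixes_of_adjacent_swap[of p a b q] uv by auto
    then show "card {i \<in> {1..n}. set (take i u) \<noteq> set (take i v)} = 1" by simp
  qed
  then show ?thesis by (auto simp: full_flag_johnson_def)
qed

text \<open>This and the next lemma translate between walks, which carry the cost, and relation
  powers, in which swaps are counted; length becomes exponent.\<close>

lemma (in wf_digraph) awalk_imp_relpow: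
  "awalk u p v \<Longrightarrow> (u, v) \<in> arcs_ends G ^^ length p"
proof (induction p arbitrary: u)
  case (Cons e p)
  then have "(u, head G e) \<in> arcs_ends G" "(head G e, v) \<in> arcs_ends G ^^ length p"
    by (auto simp: awalk_Cons_iff arcs_ends_def arc_to_ends_def)
  then show ?case by (simp add: relpow_Suc_I2 del: relpow.simps)
qed (simp add: awalk_Nil_iff)

text \<open>The 0th power relates every point to itself, whereas an empty walk must sit at a vertex;
  hence the assumption on \<open>u\<close>.\<close>

lemma (in wf_digraph) relpow_imp_awalk:
  assumes "(u, v) \<in> arcs_ends G ^^ k" "u \<in> verts G"
  shows "\<exists>p. awalk u p v \<and> length p = k"
  using assms
proof (induction k arbitrary: u)
  case (Suc k)
  then obtain w where "(u, w) \<in> arcs_ends G" "(w, v) \<in> arcs_ends G ^^ k"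
    by (meson relpow_Suc_D2)
  then obtain e where e: "e \<in> arcs G" "tail G e = u" "head G e = w"
    by (auto simp: arcs_ends_def arc_to_ends_def)
  then obtain p where "awalk w p v" "length p = k"
    using Suc.IH \<open>(w, v) \<in> arcs_ends G ^^ k\<close> head_in_verts by blast
  then show ?case
    using e by (intro exI[of _ "e # p"]) (auto simp: awalk_Cons_iff)
qed (auto simp: awalk_Nil_iff)

lemma (in wf_digraph) awalk_cost_1: "awalk_cost (\<lambda>_. 1) p = real (length p)"
  by (simp add: awalk_cost_def sum_list_triv)

theorem theorem4p1:
  fixes n :: nat
  assumes "n \<ge> 2"
  shows "wf_digraph.diameter (with_proj (full_flag_johnson n 1)) = ereal (real (n choose 2))"
proof -
  define G where "G = with_proj (full_flag_johnson n 1)"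
  interpret pair_pseudo_graph "full_flag_johnson n 1"
    by (rule pair_pseudo_graph_full_flag_johnson)
  interpret G: wf_digraph G
    unfolding G_def by (rule wf_digraph_axioms)
  have verts: "verts G = permutations_of_set {1..n}"
    by (simp add: G_def full_flag_johnson_def)
  have arcs: "(u, v) \<in> arcs_ends G \<longleftrightarrow> u \<in> verts G \<and> v \<in> verts G \<and> (u, v) \<in> adjacent_swaps"
    for u v
    unfolding verts by (simp add: G_def parcs_full_flag_johnson_1_iff del: One_nat_def)
  have mset: "mset u = mset v" if "u \<in> verts G" "v \<in> verts G" for u v
    using that set_eq_iff_mset_eq_distinct[of u v]
    by (simp add: verts permutations_of_set_def)
  have closed: "v \<in> verts G" if "u \<in> verts G" "(u, v) \<in> adjacent_swaps" for u v
    using that mset_adjacent_swaps[of u v]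
    by (auto simp: verts permutations_of_set_def dest: mset_eq_setD mset_eq_imp_distinct_iff)
  \<comment> \<open>Swaps preserve the multiset of entries, so a chain of swaps that starts at a
    vertex never leaves the graph.\<close>
  have walk: "(u, v) \<in> arcs_ends G ^^ k" if "(u, v) \<in> adjacent_swaps ^^ k" "u \<in> verts G" for u v k
    using that
  proof (induction k arbitrary: u)
    case (Suc k)
    then obtain w where "(u, w) \<in> adjacent_swaps" "(w, v) \<in> adjacent_swaps ^^ k"
      by (meson relpow_Suc_D2)
    then show ?case
      using Suc arcs closed by (meson relpow_Suc_I2)
  qed simp
  have upper: "G.\<mu> (\<lambda>_. 1) u v \<le> ereal (real (n choose 2))"
    if uv: "u \<in> verts G" "v \<in> verts G" for u v
  proof -
    have "length v = n"
      using uv by (auto simp: verts dest: length_finite_permutations_of_set)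
    then obtain k where k: "k \<le> n choose 2" "(u, v) \<in> adjacent_swaps ^^ k"
      using adjacent_swaps_sort_bound[OF mset[OF uv]] by auto
    then obtain p where "G.awalk u p v" "length p = k"
      using walk[OF k(2)] G.relpow_imp_awalk uv by blast
    then show ?thesis
      using G.min_cost_le_walk_cost[of u p v "\<lambda>_. 1"] k(1)
      by (auto simp: G.awalk_cost_1 elim!: order_trans)
  qed
  \<comment> \<open>An extremal pair: the identity has no inversions, and in its reversal every pair
    is inverted.\<close>
  let ?u = "[1..<Suc n]"
  have in_verts: "?u \<in> verts G" "rev ?u \<in> verts G"
    by (auto simp: verts permutations_of_set_def)
  have "sorted_wrt (>) (rev ?u)"
    by (simp add: sorted_wrt_rev del: upt_Suc)
  then have inv: "inversions ?u = 0" "inversions (rev ?u) = n choose 2"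
    by (simp_all add: inversions_sorted inversions_strict_decreasing del: upt_Suc)
  have lower: "ereal (real (n choose 2)) \<le> G.\<mu> (\<lambda>_. 1) ?u (rev ?u)"
    unfolding G.\<mu>_def
  \<comment> \<open>The distance is an infimum over walks, so it suffices to bound the length of
    each walk: every arc is a swap and creates at most one inversion.\<close>
  proof (rule INF_greatest)
    fix p assume "p \<in> {p. G.awalk ?u p (rev ?u)}"
    then have "(?u, rev ?u) \<in> arcs_ends G ^^ length p"
      by (auto dest: G.awalk_imp_relpow)
    moreover have "arcs_ends G ^^ k \<subseteq> adjacent_swaps ^^ k" for k
      using arcs by (induction k) (auto intro!: relcomp_mono)
    ultimately have "(?u, rev ?u) \<in> adjacent_swaps ^^ length p"
      by blast
    then show "ereal (real (n choose 2)) \<le> ereal (G.awalk_cost (\<lambda>_. 1) p)"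
      using inversions_relpow_adjacent_swaps[of ?u "rev ?u" "length p"] inv
      by (simp add: G.awalk_cost_1 del: upt_Suc)
  qed
  have "G.diameter = ereal (real (n choose 2))"
    unfolding G.diameter_def
    using upper lower in_verts by (intro antisym SUP_least SUP_upper2[of ?u] SUP_upper2[of "rev ?u"])
  then show ?thesis by (simp add: G_def)
qed

end
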